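(* Let $I\unlhd K[x_1,\dots,x_n]$ be an ideal. The projection $\mathbb R_{\le0}\times\mathbb R^n\to\mathbb R^n$ induces a bijection $$\operatorname{Trop}(\pi^{-1}I)\cap(\{-1\}\times\mathbb R^n)\longrightarrow\operatorname{Trop}_\nu(I),\qquad(-1,w_1,\dots,w_n)\mapsto(w_1,\dots,w_n).$$
   Context: Let $K$ be a complete field with a non-trivial discrete valuation $\nu:K\to\mathbb R\cup\{\infty\}$ and a uniformizing parameter $p\in K$, with $\nu$ normalized so that $\nu(p)=1$. Let $\mathcal O_K$ be its ring of integers and $\mathfrak K$ its residue field. Let $R\subseteq\mathcal O_K$ be a dense noetherian subring with $p\in R$. The map $\pi:R[[t]][x]\to\mathcal O_K[x]\subseteq K[x]$, $t\mapsto p$, has $\ker(R[[t]][x]\to\mathcal O_K[x])=\langle p-t\rangle$. $\pi^{-1}I$ denotes the preimage of $I$ in $R[[t]][x]$. For $f=\sum_\alpha c_\alpha x^\alpha\in K[x]$ and $w\in\mathbb R^n$, $\operatorname{in}_{\nu,w}(f)=\sum \overline{c_\alpha p^{-\nu(c_\alpha)}}x^\alpha\in\mathfrak K[x]$. The sum runs over the $\alpha$ with $c_\alpha\ne0$ for which $w\cdot\alpha-\nu(c_\alpha)$ is maximal. $\operatorname{in}_{\nu,w}(I)$ is the ideal generated by the $\operatorname{in}_{\nu,w}(f)$ with $f\in I$. We set $\operatorname{Trop}_\nu(I)=\{w\in\mathbb R^n:\operatorname{in}_{\nu,w}(I)\text{ contains no monomial}\}$. For $f=\sum c_{\alpha,\beta}t^\beta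 x^\alpha\in R[[t]][x]$ and $w\in\mathbb R_{<0}\times\mathbb R^n$, $\operatorname{in}_w(f)\in R[t,x]$ is the sum of the terms with $w\cdot(\beta,\alpha)$ maximal. $\operatorname{in}_w(J)$ is the ideal of $R[t,x]$ generated by the $\operatorname{in}_w(f)$ with $f\in J$. For $J\unlhd R[[t]][x]$, $\operatorname{Trop}(J)\subseteq\mathbb R_{\le0}\times\mathbb R^n$ is the Euclidean closure of the set of $w\in\mathbb R_{<0}\times\mathbb R^n$ such that $\operatorname{in}_w(J)$ contains no monomial $t^\beta x^\alpha$. *)

theory Defs
  imports "HOL-Analysis.Analysis" "HOL-Library.Poly_Mapping"
    "HOL-Computational_Algebra.Formal_Power_Series"
begin

text \<open>Multivariate polynomials in variables indexed by the finite type 'n are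
  represented as finitely supported maps from exponent vectors ('n =>0 nat)
  to coefficients. K[x] has coefficients in the field 'k; R[[t]][x] has
  coefficients in 'k fps whose coefficients lie in R; R[t,x] is the subset
  whose fps coefficients are polynomials (finite support).\<close>

type_synonym ('n,'a) mpoly = "('n \<Rightarrow>\<^sub>0 nat) \<Rightarrow>\<^sub>0 'a"

definition is_ideal_in :: "'a::comm_ring_1 set \<Rightarrow> 'a set \<Rightarrow> bool" where
  "is_ideal_in C J \<longleftrightarrow> J \<subseteq> C \<and> 0 \<in> J \<and> (\<forall>a\<in>J. \<forall>b\<in>J. a + b \<in> J)
     \<and> (\<forall>c\<in>C. \<forall>a\<in>J. c * a \<in> J)"

definition ideal_span_in :: "'a::comm_ring_1 set \<Rightarrow> 'a set \<Rightarrow> 'a set" where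
  "ideal_span_in C S = {\<Sum>i<(m::nat). h i * s i | m h s. \<forall>i<m. h i \<in> C \<and> s i \<in> S}"

definition is_subring :: "'a::comm_ring_1 set \<Rightarrow> bool" where
  "is_subring R \<longleftrightarrow> 0 \<in> R \<and> 1 \<in> R \<and> (\<forall>a\<in>R. \<forall>b\<in>R. a + b \<in> R \<and> a - b \<in> R \<and> a * b \<in> R)"

definition noetherian_subring :: "'a::comm_ring_1 set \<Rightarrow> bool" where
  "noetherian_subring R \<longleftrightarrow> is_subring R \<and>
     (\<forall>J. is_ideal_in R J \<longrightarrow> (\<exists>F. finite F \<and> F \<subseteq> J \<and> J = ideal_span_in R F))"

definition valuation :: "('k::field \<Rightarrow> ereal) \<Rightarrow> bool" where
  "valuation \<nu> \<longleftrightarrow> (\<forall>a. \<nu> a = \<infinity> \<longleftrightarrow> a = 0) \<and> (\<forall>a b. \<nu> (a * b) = \<nu> a + \<nu> b)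
     \<and> (\<forall>a b. \<nu> (a + b) \<ge> min (\<nu> a) (\<nu> b))"

definition val_converges :: "('k::field \<Rightarrow> ereal) \<Rightarrow> (nat \<Rightarrow> 'k) \<Rightarrow> 'k \<Rightarrow> bool" where
  "val_converges \<nu> s L \<longleftrightarrow> (\<forall>M::real. \<exists>N. \<forall>n\<ge>N. \<nu> (s n - L) \<ge> ereal M)"

definition val_cauchy :: "('k::field \<Rightarrow> ereal) \<Rightarrow> (nat \<Rightarrow> 'k) \<Rightarrow> bool" where
  "val_cauchy \<nu> s \<longleftrightarrow> (\<forall>M::real. \<exists>N. \<forall>m\<ge>N. \<forall>n\<ge>N. \<nu> (s m - s n) \<ge> ereal M)"

definition complete_dvf :: "('k::field \<Rightarrow> ereal) \<Rightarrow> 'k \<Rightarrow> bool" where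
  "complete_dvf \<nu> p \<longleftrightarrow> valuation \<nu> \<and> \<nu> p = 1
     \<and> \<nu> ` (UNIV - {0}) = range (\<lambda>z::int. ereal (of_int z))
     \<and> (\<forall>s. val_cauchy \<nu> s \<longrightarrow> (\<exists>L. val_converges \<nu> s L))"

definition val_ring :: "('k::field \<Rightarrow> ereal) \<Rightarrow> 'k set" where
  "val_ring \<nu> = {a. \<nu> a \<ge> 0}"

definition dense_in_val_ring :: "('k::field \<Rightarrow> ereal) \<Rightarrow> 'k set \<Rightarrow> bool" where
  "dense_in_val_ring \<nu> R \<longleftrightarrow> (\<forall>a\<in>val_ring \<nu>. \<forall>M::real. \<exists>r\<in>R. \<nu> (a - r) \<ge> ereal M)"

definition fps_eval_at :: "('k::field \<Rightarrow> ereal) \<Rightarrow> 'k \<Rightarrow> 'k fps \<Rightarrow> 'k" where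
  "fps_eval_at \<nu> p f = (THE L. val_converges \<nu> (\<lambda>N. \<Sum>k<N. fps_nth f k * p ^ k) L)"

definition pi_map :: "('k::field \<Rightarrow> ereal) \<Rightarrow> 'k \<Rightarrow> ('n, 'k fps) mpoly \<Rightarrow> ('n, 'k) mpoly" where
  "pi_map \<nu> p g = Poly_Mapping.map (fps_eval_at \<nu> p) g"

definition RTx :: "'k::field set \<Rightarrow> ('n, 'k fps) mpoly set" where
  "RTx R = {g. \<forall>\<alpha> k. fps_nth (Poly_Mapping.lookup g \<alpha>) k \<in> R}"

definition RTx_poly :: "'k::field set \<Rightarrow> ('n, 'k fps) mpoly set" where
  "RTx_poly R = {g \<in> RTx R. \<forall>\<alpha>. finite {k. fps_nth (Poly_Mapping.lookup g \<alpha>) k \<noteq> 0}}"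

definition pi_preimage :: "('k::field \<Rightarrow> ereal) \<Rightarrow> 'k \<Rightarrow> 'k set \<Rightarrow> ('n, 'k) mpoly set
    \<Rightarrow> ('n, 'k fps) mpoly set" where
  "pi_preimage \<nu> p R I = {g \<in> RTx R. pi_map \<nu> p g \<in> I}"

definition dotw :: "real ^ 'n \<Rightarrow> ('n::finite \<Rightarrow>\<^sub>0 nat) \<Rightarrow> real" where
  "dotw w \<alpha> = (\<Sum>i\<in>UNIV. w $ i * real (Poly_Mapping.lookup \<alpha> i))"

text \<open>Valued initial form over K, lifted to O_K[x]: the coefficient of each
  extremal term is c * p^(-nu c), a representative of its residue class.\<close>
definition val_weight :: "('k::field \<Rightarrow> ereal) \<Rightarrow> real ^ 'n \<Rightarrow> ('n::finite, 'k) mpoly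
    \<Rightarrow> ('n \<Rightarrow>\<^sub>0 nat) \<Rightarrow> real" where
  "val_weight \<nu> w f \<alpha> = dotw w \<alpha> - real_of_ereal (\<nu> (Poly_Mapping.lookup f \<alpha>))"

definition in_val_lift :: "('k::field \<Rightarrow> ereal) \<Rightarrow> 'k \<Rightarrow> real ^ 'n \<Rightarrow> ('n::finite, 'k) mpoly
    \<Rightarrow> ('n, 'k) mpoly" where
  "in_val_lift \<nu> p w f =
     (\<Sum>\<alpha>\<in>Poly_Mapping.keys f. if val_weight \<nu> w f \<alpha> = Max (val_weight \<nu> w f ` Poly_Mapping.keys f)
        then Poly_Mapping.single \<alpha>
               (Poly_Mapping.lookup f \<alpha> * p powi (- \<lfloor>real_of_ereal (\<nu> (Poly_Mapping.lookup f \<alpha>))\<rfloor>))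
        else 0)"

definition OKx :: "('k::field \<Rightarrow> ereal) \<Rightarrow> ('n, 'k) mpoly set" where
  "OKx \<nu> = {g. \<forall>\<alpha>. Poly_Mapping.lookup g \<alpha> \<in> val_ring \<nu>}"

text \<open>in_{nu,w}(I), an ideal of the residue polynomial ring, is the image of the
  O_K[x]-ideal generated by the lifted initial forms under reduction modulo the
  maximal ideal {nu > 0}. It contains a monomial (nonzero residue coefficient)
  iff some element of the lifted ideal is congruent to c x^alpha with nu c = 0.\<close>
definition val_initial_has_monomial :: "('k::field \<Rightarrow> ereal) \<Rightarrow> 'k \<Rightarrow> real ^ 'n
    \<Rightarrow> ('n::finite, 'k) mpoly set \<Rightarrow> bool" where
  "val_initial_has_monomial \<nu> p w I \<longleftrightarrow>
     (\<exists>g \<in> ideal_span_in (OKx \<nu>) (in_val_lift \<nu> p w ` I). \<exists>\<alpha> c. \<nu> c = 0 \<and>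
        (\<forall>\<beta>. \<nu> (Poly_Mapping.lookup (g - Poly_Mapping.single \<alpha> c) \<beta>) > 0))"

definition Trop_val :: "('k::field \<Rightarrow> ereal) \<Rightarrow> 'k \<Rightarrow> ('n::finite, 'k) mpoly set
    \<Rightarrow> (real ^ 'n) set" where
  "Trop_val \<nu> p I = {w. \<not> val_initial_has_monomial \<nu> p w I}"

definition t_weight :: "real \<times> (real ^ 'n) \<Rightarrow> ('n::finite \<Rightarrow>\<^sub>0 nat) \<Rightarrow> nat \<Rightarrow> real" where
  "t_weight W \<alpha> \<beta> = fst W * real \<beta> + dotw (snd W) \<alpha>"

definition initial_form :: "real \<times> (real ^ 'n) \<Rightarrow> ('n::finite, 'k::field fps) mpoly
    \<Rightarrow> ('n, 'k fps) mpoly" where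
  "initial_form W f =
     (let m = (SUP (\<alpha>,\<beta>) \<in> {(\<alpha>,\<beta>). fps_nth (Poly_Mapping.lookup f \<alpha>) \<beta> \<noteq> 0}. t_weight W \<alpha> \<beta>)
      in (\<Sum>\<alpha>\<in>Poly_Mapping.keys f. Poly_Mapping.single \<alpha>
            (Abs_fps (\<lambda>\<beta>. if t_weight W \<alpha> \<beta> = m then fps_nth (Poly_Mapping.lookup f \<alpha>) \<beta> else 0))))"

definition initial_has_monomial :: "'k::field set \<Rightarrow> real \<times> (real ^ 'n)
    \<Rightarrow> ('n::finite, 'k fps) mpoly set \<Rightarrow> bool" where
  "initial_has_monomial R W J \<longleftrightarrow>
     (\<exists>\<alpha> \<beta>. Poly_Mapping.single \<alpha> (fps_X ^ \<beta>) \<in> ideal_span_in (RTx_poly R) (initial_form W ` J))"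

definition Trop :: "'k::field set \<Rightarrow> ('n::finite, 'k fps) mpoly set \<Rightarrow> (real \<times> (real ^ 'n)) set" where
  "Trop R J = closure {W. fst W < 0 \<and> \<not> initial_has_monomial R W J}"

end

theory Submission
  imports Defs
begin

text \<open>Both initial ideals contain a monomial exactly when some \<open>F \<in> I\<close> has a term whose valued weight
  strictly exceeds that of all others. Such an \<open>F\<close>, scaled so that this term is \<open>p\<^sup>N x\<^sup>\<alpha>\<close> and lifted
  coefficientwise along \<open>p\<close>-adic expansions, has initial form \<open>t\<^sup>N x\<^sup>\<alpha>\<close> for \<open>(-1, w)\<close> and for all nearby
  weights, so taking the closure adds nothing to the slice. Conversely, the initial forms generate ideals
  each of whose homogeneous parts lifts, modulo the maximal ideal, to an element of \<open>I\<close>; lifting the part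
  that carries the monomial gives \<open>F\<close>.\<close>

section \<open>Multiplication by monomials\<close>

abbreviation coef :: "('a \<Rightarrow>\<^sub>0 'b::zero) \<Rightarrow> 'a \<Rightarrow> 'b" where
  "coef \<equiv> Poly_Mapping.lookup"

lemma poly_mapping_sum_single:
  "(\<Sum>\<gamma>\<in>Poly_Mapping.keys f. Poly_Mapping.single \<gamma> (coef f \<gamma>)) = f"
  by (rule poly_mapping_eqI)
    (simp add: lookup_sum lookup_single when_def not_in_keys_iff_lookup_eq_zero)

lemma single_mult_eq_sum:
  fixes f :: "'m::cancel_comm_monoid_add \<Rightarrow>\<^sub>0 'a::comm_ring_1"
  shows "Poly_Mapping.single \<gamma> a * f =
    (\<Sum>\<delta>\<in>Poly_Mapping.keys f. Poly_Mapping.single (\<gamma> + \<delta>) (a * coef f \<delta>))"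
proof -
  have "Poly_Mapping.single \<gamma> a * f = Poly_Mapping.single \<gamma> a *
      (\<Sum>\<delta>\<in>Poly_Mapping.keys f. Poly_Mapping.single \<delta> (coef f \<delta>))"
    by (simp add: poly_mapping_sum_single)
  then show ?thesis
    by (simp add: sum_distrib_left mult_single)
qed

lemma coef_single_mult:
  fixes f :: "'m::cancel_comm_monoid_add \<Rightarrow>\<^sub>0 'a::comm_ring_1"
  shows "coef (Poly_Mapping.single \<gamma> a * f) (\<gamma> + \<delta>) = a * coef f \<delta>"
  by (simp add: single_mult_eq_sum lookup_sum lookup_single when_def not_in_keys_iff_lookup_eq_zero)

lemma coef_single_mult_eq_0:
  fixes f :: "'m::cancel_comm_monoid_add \<Rightarrow>\<^sub>0 'a::comm_ring_1"
  assumes "\<And>\<delta>. \<beta> \<noteq> \<gamma> + \<delta>"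
  shows "coef (Poly_Mapping.single \<gamma> a * f) \<beta> = 0"
  using assms[symmetric] by (simp add: single_mult_eq_sum lookup_sum lookup_single when_def)

lemma dotw_add: "dotw w (\<gamma> + \<delta>) = dotw w \<gamma> + dotw w \<delta>"
  by (simp add: dotw_def lookup_add algebra_simps sum.distrib)

lemma mem_ideal_span_in:
  assumes "1 \<in> C" "s \<in> S"
  shows "s \<in> ideal_span_in C S"
proof -
  have "s = (\<Sum>i<(1::nat). 1 * s)" by simp
  with assms show ?thesis
    unfolding ideal_span_in_def by (intro CollectI exI[of _ 1] exI[of _ "\<lambda>_. 1"] exI[of _ "\<lambda>_. s"]) auto
qed

lemma single_sum: "Poly_Mapping.single \<gamma> (sum f A) = (\<Sum>i\<in>A. Poly_Mapping.single \<gamma> (f i))"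
  by (rule poly_mapping_eqI) (simp add: lookup_sum lookup_single when_def)

section \<open>The valuation and lower bounds for values\<close>

locale discrete_valuation =
  fixes \<nu> :: "'k::field \<Rightarrow> ereal" and p :: 'k
  assumes complete_dvf: "complete_dvf \<nu> p"
begin

lemma val_mult: "\<nu> (a * b) = \<nu> a + \<nu> b"
  and val_add: "min (\<nu> a) (\<nu> b) \<le> \<nu> (a + b)"
  and val_eq_infinity: "\<nu> a = \<infinity> \<longleftrightarrow> a = 0"
  and val_p: "\<nu> p = 1"
  using complete_dvf by (auto simp: complete_dvf_def valuation_def)

lemma val_0 [simp]: "\<nu> 0 = \<infinity>"
  by (simp add: val_eq_infinity)

lemma val_int:
  assumes "a \<noteq> 0"
  obtains k :: int where "\<nu> a = ereal (of_int k)"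
proof -
  have "\<nu> a \<in> range (\<lambda>z::int. ereal (of_int z))"
    using complete_dvf assms unfolding complete_dvf_def by blast
  then show thesis using that by blast
qed

lemma val_1 [simp]: "\<nu> 1 = 0"
proof -
  obtain k where k: "\<nu> 1 = ereal (of_int k)" using val_int[of 1] by auto
  have "\<nu> (1 * 1) = \<nu> 1 + \<nu> 1" by (rule val_mult)
  then show ?thesis using k by simp
qed

lemma val_minus [simp]: "\<nu> (- a) = \<nu> a"
proof -
  obtain k where k: "\<nu> (-1) = ereal (of_int k)" using val_int[of "-1"] by auto
  have "\<nu> ((-1) * (-1)) = \<nu> (-1) + \<nu> (-1)" by (rule val_mult)
  then have "\<nu> (-1) = 0" using k by simp
  then show ?thesis using val_mult[of "-1" a] by simp
qed

lemma p_nonzero [simp]: "p \<noteq> 0"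
  using val_p val_eq_infinity[of p] by auto

lemma val_inverse:
  assumes "a \<noteq> 0" "\<nu> a = ereal m"
  shows "\<nu> (inverse a) = ereal (- m)"
proof -
  obtain k where k: "\<nu> (inverse a) = ereal (of_int k)"
    using val_int[of "inverse a"] assms by auto
  have "ereal m + \<nu> (inverse a) = 0"
    using val_mult[of a "inverse a"] assms by simp
  then show ?thesis using k by (simp add: zero_ereal_def)
qed

lemma val_p_power: "\<nu> (p ^ n) = ereal (real n)"
  by (induction n) (auto simp: val_mult val_p one_ereal_def zero_ereal_def)

lemma val_p_powi: "\<nu> (p powi k) = ereal (of_int k)"
proof (cases "k \<ge> 0")
  case True
  then show ?thesis by (simp add: power_int_def val_p_power)
next
  case False
  then show ?thesis
    using val_inverse[OF _ val_p_power, of "nat (- k)"]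
    by (simp add: power_int_def power_inverse)
qed

text \<open>The bounds are real because values get compared with the real weights given by
  \<open>w\<close>. Zero meets every bound, which spares most case distinctions on vanishing
  coefficients.\<close>

definition val_ge :: "real \<Rightarrow> 'k \<Rightarrow> bool" where
  "val_ge m a \<longleftrightarrow> ereal m \<le> \<nu> a"

lemma val_ge_0 [simp]: "val_ge m 0"
  by (simp add: val_ge_def)

lemma val_ge_mono: "val_ge m a \<Longrightarrow> m' \<le> m \<Longrightarrow> val_ge m' a"
  unfolding val_ge_def by (meson ereal_less_eq(3) order_trans)

lemma val_ge_add: "val_ge m a \<Longrightarrow> val_ge m b \<Longrightarrow> val_ge m (a + b)"
  unfolding val_ge_def by (meson min.boundedI order_trans val_add)

lemma val_ge_minus: "val_ge m a \<Longrightarrow> val_ge m (- a)"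
  by (simp add: val_ge_def)

lemma val_ge_diff: "val_ge m a \<Longrightarrow> val_ge m b \<Longrightarrow> val_ge m (a - b)"
  using val_ge_add[of m a "- b"] val_ge_minus by simp

lemma val_ge_mult:
  assumes "val_ge m a" "val_ge n b"
  shows "val_ge (m + n) (a * b)"
  using add_mono[OF assms[unfolded val_ge_def]] by (simp add: val_ge_def val_mult)

lemma val_ge_sum: "(\<And>i. i \<in> A \<Longrightarrow> val_ge m (f i)) \<Longrightarrow> val_ge m (sum f A)"
  by (induction A rule: infinite_finite_induct) (auto intro: val_ge_add)

lemma val_ge_p_powi: "val_ge (of_int k) (p powi k)"
  by (simp add: val_ge_def val_p_powi)

lemma val_ge_p_power: "val_ge (real k) (p ^ k)"
  by (simp add: val_ge_def val_p_power)

text \<open>Nonzero elements have integral values, so a positive value is at least 1. Membership in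
  the maximal ideal thereby becomes a \<open>val_ge\<close> bound.\<close>

lemma val_ge_1_iff: "val_ge 1 a \<longleftrightarrow> \<nu> a > 0"
proof (cases "a = 0")
  case False
  then obtain k where "\<nu> a = ereal (of_int k)" by (rule val_int)
  then show ?thesis by (simp add: val_ge_def int_one_le_iff_zero_less)
qed simp

lemma val_ge_all_imp_0:
  assumes "\<And>n::nat. val_ge (real n) a"
  shows "a = 0"
proof (rule ccontr)
  assume "a \<noteq> 0"
  then obtain k where "\<nu> a = ereal (of_int k)" by (rule val_int)
  then have "real n \<le> of_int k" for n :: nat using assms[of n] by (simp add: val_ge_def)
  then show False by (meson not_le reals_Archimedean2)
qed

lemma val_ring_iff: "a \<in> val_ring \<nu> \<longleftrightarrow> val_ge 0 a"
  by (simp add: val_ring_def val_ge_def zero_ereal_def)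

section \<open>Convergence and evaluation of power series at p\<close>

lemma val_converges_unique:
  assumes "val_converges \<nu> s L" "val_converges \<nu> s L'"
  shows "L = L'"
proof -
  have "val_ge (real M) (L - L')" for M :: nat
  proof -
    obtain N N' where "\<forall>n\<ge>N. \<nu> (s n - L) \<ge> ereal (real M)" "\<forall>n\<ge>N'. \<nu> (s n - L') \<ge> ereal (real M)"
      using assms unfolding val_converges_def by meson
    then have "val_ge (real M) (s (max N N') - L')" "val_ge (real M) (s (max N N') - L)"
      by (auto simp: val_ge_def)
    then show ?thesis using val_ge_diff by fastforce
  qed
  then show ?thesis using val_ge_all_imp_0[of "L - L'"] by simp
qed

text \<open>Limits are unique, so the definite description in \<open>fps_eval_at\<close> is settled
  by exhibiting any limit.\<close>

lemma fps_eval_at_eqI: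
  "val_converges \<nu> (\<lambda>N. \<Sum>k<N. fps_nth f k * p ^ k) L \<Longrightarrow> fps_eval_at \<nu> p f = L"
  unfolding fps_eval_at_def by (blast intro: val_converges_unique the_equality)

lemma fps_eval_at_0 [simp]: "fps_eval_at \<nu> p 0 = 0"
  by (rule fps_eval_at_eqI) (simp add: val_converges_def)

lemma coef_pi_map: "coef (pi_map \<nu> p g) \<beta> = fps_eval_at \<nu> p (coef g \<beta>)"
  by (simp add: pi_map_def Poly_Mapping.map.rep_eq when_def)

lemma val_ge_tail:
  assumes "\<And>k. val_ge 0 (fps_nth f k)" "n \<le> m"
  shows "val_ge (real n) ((\<Sum>k<m. fps_nth f k * p ^ k) - (\<Sum>k<n. fps_nth f k * p ^ k))"
proof -
  have "val_ge (real n) (fps_nth f k * p ^ k)" if "n \<le> k" for k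
    using val_ge_mono[OF val_ge_mult[OF assms(1) val_ge_p_power]] that by simp
  moreover have "(\<Sum>k<m. fps_nth f k * p ^ k) - (\<Sum>k<n. fps_nth f k * p ^ k)
      = (\<Sum>k\<in>{n..<m}. fps_nth f k * p ^ k)"
    using assms(2) by (metis sum_diff_nat_ivl lessThan_atLeast0 le0)
  ultimately show ?thesis by (auto intro: val_ge_sum)
qed

text \<open>Completeness supplies the limit. Every term from index n on has value at least n, and
  the ultrametric inequality carries this bound over to the limit.\<close>

lemma fps_eval_at_remainder:
  assumes "\<And>k. val_ge 0 (fps_nth f k)"
  shows "val_ge (real n) (fps_eval_at \<nu> p f - (\<Sum>k<n. fps_nth f k * p ^ k))"
proof -
  define s where "s N = (\<Sum>k<N. fps_nth f k * p ^ k)" for N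
  have tail: "val_ge (real n) (s m - s n)" if "n \<le> m" for n m
    using val_ge_tail[OF assms that] by (simp add: s_def)
  have "val_cauchy \<nu> s"
    unfolding val_cauchy_def
  proof (intro allI)
    fix M :: real
    obtain N :: nat where N: "M \<le> real N" using real_arch_simple by blast
    have "val_ge M (s m - s n)" if "m \<ge> N" "n \<ge> N" for m n
      using val_ge_diff[OF tail[OF that(1)] tail[OF that(2)]] N val_ge_mono by fastforce
    then show "\<exists>N. \<forall>m\<ge>N. \<forall>n\<ge>N. ereal M \<le> \<nu> (s m - s n)"
      by (auto simp: val_ge_def)
  qed
  then obtain L where L: "val_converges \<nu> s L"
    using complete_dvf unfolding complete_dvf_def by blast
  then have eval: "fps_eval_at \<nu> p f = L"
    unfolding s_def by (rule fps_eval_at_eqI)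
  obtain N where "\<forall>m\<ge>N. \<nu> (s m - L) \<ge> ereal (real n)"
    using L unfolding val_converges_def by blast
  \<comment> \<open>The index \<open>max N n\<close> is late enough both for closeness to
    \<open>L\<close> and for the tail bound starting at \<open>n\<close>.\<close>
  then have "val_ge (real n) (s (max N n) - L)" by (simp add: val_ge_def)
  with tail[of n "max N n"] show ?thesis
    using val_ge_diff[of n "s (max N n) - s n" "s (max N n) - L"] by (simp add: eval s_def)
qed

section \<open>Lifting elements of the valuation ring to power series over R\<close>

text \<open>Successive approximation: density yields an element of \<open>R\<close> congruent to the
  current remainder modulo the maximal ideal; subtract it, divide by p and repeat.\<close>

lemma dense_digit_expansion:
  assumes R: "R \<subseteq> val_ring \<nu>" "dense_in_val_ring \<nu> R" and c: "val_ge 0 c"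
  obtains a where "\<And>k. a k \<in> R" "\<And>n. val_ge (real n) ((\<Sum>k<n. a k * p ^ k) - c)"
proof -
  have "\<exists>r\<in>R. val_ge 1 (x - r)" if "val_ge 0 x" for x
    using R(2)[unfolded dense_in_val_ring_def, rule_format, of x 1] that
    by (simp add: val_ring_iff val_ge_def)
  then obtain d where d: "\<And>x. val_ge 0 x \<Longrightarrow> d x \<in> R \<and> val_ge 1 (x - d x)"
    by metis
  \<comment> \<open>\<open>r n\<close> is the remainder after n digits: c is the sum of the first n
    terms plus \<open>r n * p ^ n\<close>.\<close>
  define r where "r = rec_nat c (\<lambda>_ x. (x - d x) * inverse p)"
  have r_Suc: "r (Suc n) = (r n - d (r n)) * inverse p" and r0: "r 0 = c" for n
    by (simp_all add: r_def)
  have inv: "val_ge (-1) (inverse p)"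
    using val_inverse[of p 1] val_p by (simp add: val_ge_def one_ereal_def)
  have r: "val_ge 0 (r n)" for n
  proof (induction n)
    case (Suc n)
    then show ?case using val_ge_mult[OF _ inv, of 1 "r n - d (r n)"] d by (simp add: r_Suc)
  qed (simp add: r0 c)
  have "(\<Sum>k<n. d (r k) * p ^ k) - c = - (r n * p ^ n)" for n
    by (induction n) (auto simp: r0 r_Suc field_simps)
  moreover have "val_ge (real n) (- (r n * p ^ n))" for n
    using val_ge_minus[OF val_ge_mult[OF r val_ge_p_power]] by simp
  ultimately have "val_ge (real n) ((\<Sum>k<n. d (r k) * p ^ k) - c)" for n
    by metis
  with d r show thesis by (intro that[of "\<lambda>k. d (r k)"]) blast+
qed

text \<open>Division by p^v leaves c integral, and the digit expansion of the quotient is shifted by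
  t^v. The lift is thus divisible by as high a power of t as the value of c allows, which keeps its
  weights low.\<close>

lemma dense_lift:
  assumes R: "R \<subseteq> val_ring \<nu>" "dense_in_val_ring \<nu> R" "0 \<in> R" and c: "val_ge (real v) c"
  obtains f where "\<And>k. fps_nth f k \<in> R" "\<And>k. k < v \<Longrightarrow> fps_nth f k = 0" "fps_eval_at \<nu> p f = c"
proof -
  have "val_ge 0 (c * p powi (- int v))"
    using val_ge_mult[OF c val_ge_p_powi[of "- int v"]] by simp
  then obtain a where a: "\<And>k. a k \<in> R"
    "\<And>n. val_ge (real n) ((\<Sum>k<n. a k * p ^ k) - c * p powi (- int v))"
    using dense_digit_expansion[OF R(1,2)] by metis
  define f where "f = fps_X ^ v * Abs_fps a"
  have f: "fps_nth f k = (if k < v then 0 else a (k - v))" for k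
    by (simp add: f_def fps_X_power_mult_nth)
  have sum: "(\<Sum>k<n + v. fps_nth f k * p ^ k) = p ^ v * (\<Sum>k<n. a k * p ^ k)" for n
    by (induction n) (auto simp: f algebra_simps power_add)
  have c_eq: "p ^ v * (c * p powi (- int v)) = c"
    by (simp add: power_int_minus)
  have close: "val_ge (real n) ((\<Sum>k<n + v. fps_nth f k * p ^ k) - c)" for n
  proof -
    have "(\<Sum>k<n + v. fps_nth f k * p ^ k) - c = p ^ v * ((\<Sum>k<n. a k * p ^ k) - c * p powi (- int v))"
      using c_eq by (simp add: sum right_diff_distrib)
    then show ?thesis
      using val_ge_mono[OF val_ge_mult[OF val_ge_p_power a(2)], of n v n] by simp
  qed
  have "val_converges \<nu> (\<lambda>N. \<Sum>k<N. fps_nth f k * p ^ k) c"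
    unfolding val_converges_def
  proof (intro allI)
    fix M :: real
    obtain N :: nat where N: "M \<le> real N" using real_arch_simple by blast
    have "val_ge M ((\<Sum>k<n. fps_nth f k * p ^ k) - c)" if "n \<ge> N + v" for n
      using close[of "n - v"] that N val_ge_mono[of "real (n - v)" _ M] by simp
    then show "\<exists>N. \<forall>n\<ge>N. ereal M \<le> \<nu> ((\<Sum>k<n. fps_nth f k * p ^ k) - c)"
      by (auto simp: val_ge_def)
  qed
  then have "fps_eval_at \<nu> p f = c" by (rule fps_eval_at_eqI)
  then show thesis using that[of f] a(1) R(3) f by simp
qed


section \<open>Lifting homogeneous parts to elements of I\<close>

text \<open>\<open>G \<beta> k\<close> stands for a coefficient at \<open>t\<^sup>k x\<^sup>\<beta>\<close>, with \<open>k\<close> also negative: the predicate says that the part of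
  \<open>G\<close> of weight \<open>\<theta>\<close> for \<open>(-1, w)\<close> is, modulo the maximal ideal, the initial part of an element of \<open>I\<close>.\<close>
definition lifts_to :: "real ^ 'n \<Rightarrow> ('n::finite, 'k) mpoly set \<Rightarrow> real
    \<Rightarrow> (('n \<Rightarrow>\<^sub>0 nat) \<Rightarrow> int \<Rightarrow> 'k) \<Rightarrow> bool" where
  "lifts_to w I \<theta> G \<longleftrightarrow> (\<exists>F\<in>I. \<forall>\<beta>. val_ge (dotw w \<beta> - \<theta>) (coef F \<beta>) \<and>
     (\<forall>k::int. of_int k = dotw w \<beta> - \<theta> \<longrightarrow> val_ge (of_int k + 1) (coef F \<beta> - G \<beta> k * p powi k)))"

lemma lifts_to_0: "is_ideal_in UNIV I \<Longrightarrow> lifts_to w I \<theta> (\<lambda>\<beta> k. 0)"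
  unfolding lifts_to_def by (intro bexI[of _ 0]) (auto simp: is_ideal_in_def)

lemma lifts_to_add:
  assumes I: "is_ideal_in UNIV I" and "lifts_to w I \<theta> G" "lifts_to w I \<theta> H"
  shows "lifts_to w I \<theta> (\<lambda>\<beta> k. G \<beta> k + H \<beta> k)"
proof -
  obtain F where F: "F \<in> I" "\<And>\<beta>. val_ge (dotw w \<beta> - \<theta>) (coef F \<beta>)"
    "\<And>\<beta> k. of_int k = dotw w \<beta> - \<theta> \<Longrightarrow> val_ge (of_int k + 1) (coef F \<beta> - G \<beta> k * p powi k)"
    using assms(2) unfolding lifts_to_def by metis
  obtain E where E: "E \<in> I" "\<And>\<beta>. val_ge (dotw w \<beta> - \<theta>) (coef E \<beta>)"
    "\<And>\<beta> k. of_int k = dotw w \<beta> - \<theta> \<Longrightarrow> val_ge (of_int k + 1) (coef E \<beta> - H \<beta> k * p powi k)"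
    using assms(3) unfolding lifts_to_def by metis
  have "F + E \<in> I" using I F(1) E(1) unfolding is_ideal_in_def by blast
  moreover have "val_ge (of_int k + 1) (coef (F + E) \<beta> - (G \<beta> k + H \<beta> k) * p powi k)"
    if "of_int k = dotw w \<beta> - \<theta>" for \<beta> k
    using val_ge_add[OF F(3)[OF that] E(3)[OF that]] by (simp add: lookup_add algebra_simps)
  ultimately show ?thesis
    unfolding lifts_to_def
    by (intro bexI[of _ "F + E"]) (auto simp: lookup_add intro: val_ge_add F(2) E(2))
qed

lemma lifts_to_sum:
  assumes "is_ideal_in UNIV I" "finite A" "\<And>i. i \<in> A \<Longrightarrow> lifts_to w I \<theta> (G i)"
  shows "lifts_to w I \<theta> (\<lambda>\<beta> k. \<Sum>i\<in>A. G i \<beta> k)"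
  using assms(2,3) by (induction A) (auto intro: lifts_to_0 lifts_to_add assms(1))

text \<open>The term r t^j x^\<gamma> has weight \<open>dotw w \<gamma> - real j\<close>, so it
  takes the part of weight \<open>\<theta> + real j - dotw w \<gamma>\<close> to the part of weight
  \<theta>; on the lift, t^j acts as p^j. \<open>H\<close> is described by its coefficients only, so
  that the lemma serves both K[x] and R[t,x].\<close>

lemma lifts_to_monomial_mult:
  assumes I: "is_ideal_in UNIV I" and G: "lifts_to w I (\<theta> + real j - dotw w \<gamma>) G" and r: "val_ge 0 r"
    and H: "\<And>\<delta> k. H (\<gamma> + \<delta>) k = r * G \<delta> (k - int j)"
    and H0: "\<And>\<beta> k. (\<And>\<delta>. \<beta> \<noteq> \<gamma> + \<delta>) \<Longrightarrow> H \<beta> k = 0"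
  shows "lifts_to w I \<theta> H"
proof -
  obtain F where F: "F \<in> I" "\<And>\<beta>. val_ge (dotw w \<beta> - (\<theta> + real j - dotw w \<gamma>)) (coef F \<beta>)"
    "\<And>\<beta> k. of_int k = dotw w \<beta> - (\<theta> + real j - dotw w \<gamma>) \<Longrightarrow>
      val_ge (of_int k + 1) (coef F \<beta> - G \<beta> k * p powi k)"
    using G unfolding lifts_to_def by metis
  define E where "E = Poly_Mapping.single \<gamma> (r * p ^ j) * F"
  have E: "E \<in> I" using I F(1) unfolding E_def is_ideal_in_def by blast
  have rp: "val_ge (real j) (r * p ^ j)"
    using val_ge_mult[OF r val_ge_p_power] by simp
  have "val_ge (dotw w \<beta> - \<theta>) (coef E \<beta>) \<and>
     (\<forall>k::int. of_int k = dotw w \<beta> - \<theta> \<longrightarrow> val_ge (of_int k + 1) (coef E \<beta> - H \<beta> k * p powi k))" for \<beta>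
  proof (cases "\<exists>\<delta>. \<beta> = \<gamma> + \<delta>")
    case False
    then have "coef E \<beta> = 0" "H \<beta> k = 0" for k
      using coef_single_mult_eq_0[of \<beta> \<gamma>] H0 by (auto simp: E_def)
    then show ?thesis by simp
  next
    case True
    then obtain \<delta> where \<beta>: "\<beta> = \<gamma> + \<delta>" ..
    have c: "coef E \<beta> = r * p ^ j * coef F \<delta>"
      by (simp add: \<beta> E_def coef_single_mult)
    have "val_ge (of_int k + 1) (coef E \<beta> - H \<beta> k * p powi k)" if k: "of_int k = dotw w \<beta> - \<theta>" for k
    proof -
      have "of_int (k - int j) = dotw w \<delta> - (\<theta> + real j - dotw w \<gamma>)"
        using k by (simp add: \<beta> dotw_add)
      from val_ge_mult[OF rp F(3)[OF this]]
      have "val_ge (of_int k + 1) (r * p ^ j * (coef F \<delta> - G \<delta> (k - int j) * p powi (k - int j)))"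
        by simp
      moreover have "p ^ j * p powi (k - int j) = p powi k"
        by (simp add: power_int_diff)
      then have "r * G \<delta> (k - int j) * (p ^ j * p powi (k - int j)) = H \<beta> k * p powi k"
        by (simp add: \<beta> H)
      then have "r * p ^ j * (coef F \<delta> - G \<delta> (k - int j) * p powi (k - int j)) = coef E \<beta> - H \<beta> k * p powi k"
        unfolding c by (simp only: right_diff_distrib ac_simps)
      ultimately show ?thesis by simp
    qed
    moreover have "val_ge (dotw w \<beta> - \<theta>) (coef E \<beta>)"
      using val_ge_mult[OF rp F(2)[of \<delta>]] by (simp add: c) (simp add: \<beta> dotw_add algebra_simps)
    ultimately show ?thesis by blast
  qed
  then show ?thesis using E unfolding lifts_to_def by blast
qed

text \<open>The comparison is confined to \<open>keys F\<close>: at a zero coefficient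
  \<open>val_weight\<close> is meaningless, as \<open>real_of_ereal\<close> sends \<infinity> to
  0.\<close>

definition has_dominant_term :: "real ^ 'n \<Rightarrow> ('n::finite, 'k) mpoly \<Rightarrow> ('n \<Rightarrow>\<^sub>0 nat) \<Rightarrow> bool" where
  "has_dominant_term w F \<alpha> \<longleftrightarrow> coef F \<alpha> \<noteq> 0 \<and>
     (\<forall>\<beta>\<in>Poly_Mapping.keys F. \<beta> \<noteq> \<alpha> \<longrightarrow> val_weight \<nu> w F \<beta> < val_weight \<nu> w F \<alpha>)"

text \<open>At \<alpha> the lift is congruent to a unit times p^b, so its weight there is exactly
  \<theta>. At any other exponent weight \<theta> could only be reached by a coefficient that is
  nonzero modulo the maximal ideal in \<open>G\<close>, and there is none.\<close>

lemma lifts_to_imp_dominant_term: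
  assumes G: "lifts_to w I \<theta> G" and b: "dotw w \<alpha> - \<theta> = of_int b" and unit: "\<nu> (G \<alpha> b) = 0"
    and small: "\<And>\<beta> k. \<beta> \<noteq> \<alpha> \<Longrightarrow> val_ge 1 (G \<beta> k)"
  obtains F where "F \<in> I" "has_dominant_term w F \<alpha>"
proof -
  obtain F where F: "F \<in> I" "\<And>\<beta>. val_ge (dotw w \<beta> - \<theta>) (coef F \<beta>)"
    "\<And>\<beta> k. of_int k = dotw w \<beta> - \<theta> \<Longrightarrow> val_ge (of_int k + 1) (coef F \<beta> - G \<beta> k * p powi k)"
    using G unfolding lifts_to_def by metis
  have not_ge: "\<not> val_ge (of_int b + 1) (coef F \<alpha>)"
  proof
    assume "val_ge (of_int b + 1) (coef F \<alpha>)"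
    then have "val_ge (of_int b + 1) (G \<alpha> b * p powi b)"
      using val_ge_diff[OF _ F(3)[OF b[symmetric]]] by fastforce
    then show False using unit by (simp add: val_ge_def val_mult val_p_powi)
  qed
  then have nz: "coef F \<alpha> \<noteq> 0" by auto
  then obtain a where a: "\<nu> (coef F \<alpha>) = ereal (of_int a)" by (rule val_int)
  \<comment> \<open>Values are integral, so b \<le> a < b + 1 determines a.\<close>
  have "a = b" using F(2)[of \<alpha>] not_ge a by (simp add: b val_ge_def)
  then have weight_\<alpha>: "val_weight \<nu> w F \<alpha> = \<theta>"
    using b by (simp add: val_weight_def a)
  have "val_weight \<nu> w F \<beta> < \<theta>" if "\<beta> \<in> Poly_Mapping.keys F" "\<beta> \<noteq> \<alpha>" for \<beta>
  proof -
    have "coef F \<beta> \<noteq> 0" using that(1) by (simp add: in_keys_iff)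
    then obtain v where v: "\<nu> (coef F \<beta>) = ereal (of_int v)" by (rule val_int)
    \<comment> \<open>This makes the bound \<open>F(2)\<close> strict at \<beta>.\<close>
    have "dotw w \<beta> - \<theta> \<noteq> of_int v"
    proof
      assume "dotw w \<beta> - \<theta> = of_int v"
      then have "val_ge (of_int v + 1) (coef F \<beta> - G \<beta> v * p powi v)" by (intro F(3)) simp
      moreover have "val_ge (of_int v + 1) (G \<beta> v * p powi v)"
        using val_ge_mult[OF small[OF that(2)] val_ge_p_powi] by (simp add: add.commute)
      ultimately have "val_ge (of_int v + 1) (coef F \<beta>)" using val_ge_add by fastforce
      then show False by (simp add: v val_ge_def)
    qed
    then show ?thesis using F(2)[of \<beta>] by (simp add: v val_ge_def val_weight_def)
  qed
  then show thesis using that F(1) nz by (simp add: has_dominant_term_def weight_\<alpha>)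
qed

section \<open>The valued initial ideal\<close>

lemma coef_in_val_lift:
  "coef (in_val_lift \<nu> p w f) \<beta> =
    (if \<beta> \<in> Poly_Mapping.keys f \<and> val_weight \<nu> w f \<beta> = Max (val_weight \<nu> w f ` Poly_Mapping.keys f)
     then coef f \<beta> * p powi (- \<lfloor>real_of_ereal (\<nu> (coef f \<beta>))\<rfloor>) else 0)"
  (is "_ = (if _ \<and> ?P \<beta> then ?c \<beta> else 0)")
proof -
  have "coef (in_val_lift \<nu> p w f) \<beta> = (\<Sum>\<alpha>\<in>Poly_Mapping.keys f. if \<alpha> = \<beta> then (if ?P \<beta> then ?c \<beta> else 0) else 0)"
    unfolding in_val_lift_def lookup_sum
    by (rule sum.cong) (auto simp: lookup_single when_def)
  then show ?thesis by simp
qed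

text \<open>No t occurs here, so the coefficient is placed at every \<open>k\<close>; the part of
  weight \<theta> then consists of the exponents with \<open>dotw w \<beta> - \<theta>\<close>
  integral. As extremal terms share the weight m and have integral values, this holds for all of
  them or for none, according to whether m - \<theta> is an integer.\<close>

lemma lifts_to_in_val_lift:
  assumes I: "is_ideal_in UNIV I" and f: "f \<in> I"
  shows "lifts_to w I \<theta> (\<lambda>\<beta> k. coef (in_val_lift \<nu> p w f) \<beta>)"
proof -
  \<comment> \<open>For f = 0 this is an unspecified number, which does no harm since all
    coefficients vanish.\<close>
  define m where "m = Max (val_weight \<nu> w f ` Poly_Mapping.keys f)"
  have le_m: "val_weight \<nu> w f \<beta> \<le> m" if "coef f \<beta> \<noteq> 0" for \<beta>
    using that by (simp add: m_def in_keys_iff)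
  have coef_0: "coef (in_val_lift \<nu> p w f) \<beta> = 0" if "coef f \<beta> = 0 \<or> val_weight \<nu> w f \<beta> \<noteq> m" for \<beta>
    using that by (auto simp: coef_in_val_lift m_def)
  show ?thesis
  proof (cases "\<exists>z::int. m - \<theta> = of_int z")
    case True
    then obtain z :: int where z: "m - \<theta> = of_int z" ..
    \<comment> \<open>Multiplication by p^z lowers all weights by z, taking the maximum from m to
      \<theta>.\<close>
    define F where "F = Poly_Mapping.single 0 (p powi z) * f"
    have "F \<in> I" using I f unfolding F_def is_ideal_in_def by blast
    moreover have "val_ge (dotw w \<beta> - \<theta>) (coef F \<beta>) \<and> (\<forall>k::int. of_int k = dotw w \<beta> - \<theta> \<longrightarrow>
        val_ge (of_int k + 1) (coef F \<beta> - coef (in_val_lift \<nu> p w f) \<beta> * p powi k))" for \<beta>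
    proof (cases "coef f \<beta> = 0")
      case True
      then show ?thesis using coef_single_mult[of 0 _ f \<beta>] by (simp add: F_def coef_0)
    next
      case False
      then obtain v where v: "\<nu> (coef f \<beta>) = ereal (of_int v)" by (rule val_int)
      have c: "coef F \<beta> = p powi z * coef f \<beta>"
        using coef_single_mult[of 0 _ f \<beta>] by (simp add: F_def)
      have val: "\<nu> (coef F \<beta>) = ereal (of_int (z + v))"
        by (simp add: c val_mult val_p_powi v)
      have le: "dotw w \<beta> - of_int v \<le> m"
        using le_m[OF False] by (simp add: val_weight_def v)
      have "val_ge (of_int k + 1) (coef F \<beta> - coef (in_val_lift \<nu> p w f) \<beta> * p powi k)"
        if k: "of_int k = dotw w \<beta> - \<theta>" for k
      proof (cases "val_weight \<nu> w f \<beta> = m")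
        case True
        then have "real_of_int k = of_int (z + v)"
          using k z by (simp add: val_weight_def v)
        then have "k = z + v" by linarith
        moreover have "coef (in_val_lift \<nu> p w f) \<beta> = coef f \<beta> * p powi (- v)"
          using True False by (simp add: coef_in_val_lift m_def in_keys_iff v)
        ultimately have "coef F \<beta> = coef (in_val_lift \<nu> p w f) \<beta> * p powi k"
          by (simp add: c power_int_add power_int_minus)
        then show ?thesis by simp
      next
        case neq: False
        then have "real_of_int k < of_int (z + v)"
          using le k z by (simp add: val_weight_def v)
        \<comment> \<open>Both sides are integers, so the strict inequality gains a full 1.\<close>
        then have "real_of_int k + 1 \<le> of_int (z + v)"
          unfolding of_int_less_iff by linarith
        then show ?thesis using neq by (simp add: coef_0 val_ge_def val)
      qed
      moreover have "val_ge (dotw w \<beta> - \<theta>) (coef F \<beta>)"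
        using le z by (simp add: val_ge_def val)
      ultimately show ?thesis by blast
    qed
    ultimately show ?thesis unfolding lifts_to_def by blast
  next
    case False
    have "coef (in_val_lift \<nu> p w f) \<beta> = 0" if k: "of_int k = dotw w \<beta> - \<theta>" for \<beta> and k :: int
    proof (rule ccontr)
      assume "coef (in_val_lift \<nu> p w f) \<beta> \<noteq> 0"
      then have nz: "coef f \<beta> \<noteq> 0" and m: "val_weight \<nu> w f \<beta> = m" using coef_0 by auto
      from nz obtain v where v: "\<nu> (coef f \<beta>) = ereal (of_int v)" by (rule val_int)
      have "m - \<theta> = of_int (k - v)" using m k by (simp add: val_weight_def v)
      then show False using False by blast
    qed
    then show ?thesis
      unfolding lifts_to_def using I by (intro bexI[of _ 0]) (auto simp: is_ideal_in_def)
  qed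
qed

text \<open>\<open>h\<close> is a sum of integral multiples of monomials. Each monomial shifts the
  weight by a different amount, hence the assumption on \<open>g\<close> for every \<theta>.\<close>

lemma lifts_to_OKx_mult:
  assumes I: "is_ideal_in UNIV I" and h: "h \<in> OKx \<nu>"
    and g: "\<And>\<theta>. lifts_to w I \<theta> (\<lambda>\<beta> k. coef g \<beta>)"
  shows "lifts_to w I \<theta> (\<lambda>\<beta> k. coef (h * g) \<beta>)"
proof -
  have "h * g = (\<Sum>\<gamma>\<in>Poly_Mapping.keys h. Poly_Mapping.single \<gamma> (coef h \<gamma>)) * g"
    by (simp add: poly_mapping_sum_single)
  then have hg: "h * g = (\<Sum>\<gamma>\<in>Poly_Mapping.keys h. Poly_Mapping.single \<gamma> (coef h \<gamma>) * g)"
    by (simp add: sum_distrib_right)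
  have "lifts_to w I \<theta> (\<lambda>\<beta> k. coef (Poly_Mapping.single \<gamma> (coef h \<gamma>) * g) \<beta>)" for \<gamma>
    using h g by (intro lifts_to_monomial_mult[OF I, of w \<theta> 0 \<gamma> "\<lambda>\<beta> k. coef g \<beta>" "coef h \<gamma>"])
      (auto simp: OKx_def val_ring_iff coef_single_mult intro: coef_single_mult_eq_0)
  then show ?thesis
    unfolding hg lookup_sum by (intro lifts_to_sum I) auto
qed

text \<open>An element of the lifted ideal that reduces to a monomial has a unit coefficient at
  \<alpha> and all others in the maximal ideal, which is the situation of
  \<open>lifts_to_imp_dominant_term\<close>.\<close>

lemma val_initial_has_monomial_imp_dominant_term:
  assumes I: "is_ideal_in UNIV I" and "val_initial_has_monomial \<nu> p w I"
  obtains F \<alpha> where "F \<in> I" "has_dominant_term w F \<alpha>"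
proof -
  obtain g \<alpha> c where g: "g \<in> ideal_span_in (OKx \<nu>) (in_val_lift \<nu> p w ` I)" and c: "\<nu> c = 0"
    and small: "\<And>\<beta>. val_ge 1 (coef (g - Poly_Mapping.single \<alpha> c) \<beta>)"
    using assms(2) unfolding val_initial_has_monomial_def val_ge_1_iff by blast
  obtain m h s where g_eq: "g = (\<Sum>i<(m::nat). h i * s i)"
    and hs: "\<And>i. i < m \<Longrightarrow> h i \<in> OKx \<nu> \<and> s i \<in> in_val_lift \<nu> p w ` I"
    using g unfolding ideal_span_in_def by blast
  \<comment> \<open>With this choice of \<theta> the exponent \<open>b\<close> at \<alpha> is
    0.\<close>
  have "lifts_to w I (dotw w \<alpha>) (\<lambda>\<beta> k. coef g \<beta>)"
    unfolding g_eq lookup_sum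
    using hs by (intro lifts_to_sum lifts_to_OKx_mult I) (auto 4 3 intro: lifts_to_in_val_lift[OF I] dest: hs)
  moreover have "\<nu> (coef g \<alpha>) = 0"
  proof -
    have 1: "val_ge 1 (coef g \<alpha> - c)" using small[of \<alpha>] by (simp add: lookup_minus)
    have 2: "val_ge 0 (coef g \<alpha>)"
      using val_ge_add[OF val_ge_mono[OF 1, of 0], of c] c by (simp add: val_ge_def)
    have "\<not> val_ge 1 (coef g \<alpha>)"
    proof
      assume "val_ge 1 (coef g \<alpha>)"
      from val_ge_diff[OF this 1] show False using c by (simp add: val_ge_1_iff)
    qed
    moreover have "0 \<le> \<nu> (coef g \<alpha>)" using 2 by (simp add: val_ge_def zero_ereal_def)
    ultimately show ?thesis unfolding val_ge_1_iff by auto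
  qed
  moreover have "val_ge 1 (coef g \<beta>)" if "\<beta> \<noteq> \<alpha>" for \<beta>
    using small[of \<beta>] that by (simp add: lookup_minus lookup_single)
  ultimately obtain F where "F \<in> I" "has_dominant_term w F \<alpha>"
    by (elim lifts_to_imp_dominant_term[where b = 0]) auto
  then show thesis by (rule that)
qed

text \<open>Only the dominant term survives, so the lifted initial form of \<open>F\<close> is
  itself a unit times x^\<alpha>.\<close>

lemma dominant_term_imp_val_initial_has_monomial:
  assumes F: "F \<in> I" "has_dominant_term w F \<alpha>"
  shows "val_initial_has_monomial \<nu> p w I"
proof -
  have nz: "coef F \<alpha> \<noteq> 0" and key: "\<alpha> \<in> Poly_Mapping.keys F"
    using F(2) by (auto simp: has_dominant_term_def in_keys_iff)
  have Max: "Max (val_weight \<nu> w F ` Poly_Mapping.keys F) = val_weight \<nu> w F \<alpha>"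
    using F(2) key by (intro Max_eqI) (auto simp: has_dominant_term_def intro: less_imp_le)
  obtain v where v: "\<nu> (coef F \<alpha>) = ereal (of_int v)" using nz by (rule val_int)
  have "in_val_lift \<nu> p w F = Poly_Mapping.single \<alpha> (coef F \<alpha> * p powi (- v))"
    using F(2) key
    by (intro poly_mapping_eqI) (auto simp: coef_in_val_lift Max lookup_single v has_dominant_term_def)
  moreover have "\<nu> (coef F \<alpha> * p powi (- v)) = 0"
    by (simp only: val_mult val_p_powi v) (simp add: zero_ereal_def)
  moreover have "in_val_lift \<nu> p w F \<in> ideal_span_in (OKx \<nu>) (in_val_lift \<nu> p w ` I)"
    using F(1) by (intro mem_ideal_span_in) (auto simp: OKx_def val_ring_def lookup_one when_def)
  ultimately show ?thesis
    unfolding val_initial_has_monomial_def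
    by (intro bexI[of _ "in_val_lift \<nu> p w F"] exI[of _ \<alpha>] exI[of _ "coef F \<alpha> * p powi (- v)"]) auto
qed

section \<open>The initial ideal over R[[t]]\<close>

lemma nth_coef_initial_form:
  "fps_nth (coef (initial_form W f) \<beta>) k =
    (if t_weight W \<beta> k = (SUP (\<alpha>,\<beta>) \<in> {(\<alpha>,\<beta>). fps_nth (coef f \<alpha>) \<beta> \<noteq> 0}. t_weight W \<alpha> \<beta>)
     then fps_nth (coef f \<beta>) k else 0)"
  by (auto simp: initial_form_def Let_def lookup_sum lookup_single when_def
      not_in_keys_iff_lookup_eq_zero)

text \<open>The real supremum in \<open>initial_form\<close> is an upper bound only for a bounded
  set. Powers of t never raise the weight when \<open>fst W < 0\<close>, and only finitely many
  powers of x occur.\<close>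

lemma bdd_above_t_weight:
  assumes "fst W < 0"
  shows "bdd_above ((\<lambda>(\<alpha>,\<beta>). t_weight W \<alpha> \<beta>) ` {(\<alpha>,\<beta>). fps_nth (coef f \<alpha>) \<beta> \<noteq> 0})"
proof (rule bdd_aboveI2, clarify)
  fix \<alpha> \<beta> assume "fps_nth (coef f \<alpha>) \<beta> \<noteq> 0"
  then have "\<alpha> \<in> Poly_Mapping.keys f" by (auto simp: in_keys_iff)
  then have "dotw (snd W) \<alpha> \<le> Max (dotw (snd W) ` Poly_Mapping.keys f)" by simp
  moreover have "fst W * real \<beta> \<le> 0" using assms by (simp add: mult_nonpos_nonneg)
  ultimately show "t_weight W \<alpha> \<beta> \<le> Max (dotw (snd W) ` Poly_Mapping.keys f)"
    by (simp add: t_weight_def)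
qed

text \<open>Extension by zero to negative exponents lets a shift by t^j be written as
  \<open>k - int j\<close> unconditionally.\<close>

definition fps_nth_int :: "'k fps \<Rightarrow> int \<Rightarrow> 'k" where
  "fps_nth_int f k = (if k \<ge> 0 then fps_nth f (nat k) else 0)"

text \<open>The initial form is homogeneous of weight m, so for other \<theta> the element 0 is a
  lift. For \<theta> = m the lift is \<open>pi_map \<nu> p f\<close>: the series at \<beta> starts
  no earlier than at \<open>dotw w \<beta> - m\<close>, so modulo the next power of p its value is
  its first possible term.\<close>

lemma lifts_to_initial_form:
  assumes I: "is_ideal_in UNIV I" and R: "R \<subseteq> val_ring \<nu>" and f: "f \<in> pi_preimage \<nu> p R I"
  shows "lifts_to w I \<theta> (\<lambda>\<beta>. fps_nth_int (coef (initial_form (-1, w) f) \<beta>))"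
proof -
  define m where "m = (SUP (\<alpha>,\<beta>) \<in> {(\<alpha>,\<beta>). fps_nth (coef f \<alpha>) \<beta> \<noteq> 0}. t_weight (-1, w) \<alpha> \<beta>)"
  have in_f: "fps_nth (coef (initial_form (-1, w) f) \<beta>) k =
      (if dotw w \<beta> - real k = m then fps_nth (coef f \<beta>) k else 0)" for \<beta> k
    by (simp add: nth_coef_initial_form m_def t_weight_def)
  have le_m: "dotw w \<beta> - real k \<le> m" if "fps_nth (coef f \<beta>) k \<noteq> 0" for \<beta> k
    using cSUP_upper[OF _ bdd_above_t_weight[of "(-1, w)" f], of "(\<beta>, k)"] that
    by (simp add: m_def t_weight_def)
  have f_int: "val_ge 0 (fps_nth (coef f \<beta>) k)" for \<beta> k
    using f R by (auto simp: pi_preimage_def RTx_def val_ring_iff[symmetric])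
  show ?thesis
  proof (cases "\<theta> = m")
    case False
    have "fps_nth_int (coef (initial_form (-1, w) f) \<beta>) k = 0" if "of_int k = dotw w \<beta> - \<theta>" for \<beta> k
      using that False by (auto simp: fps_nth_int_def in_f)
    then show ?thesis
      unfolding lifts_to_def using I by (intro bexI[of _ 0]) (auto simp: is_ideal_in_def)
  next
    case True
    have "pi_map \<nu> p f \<in> I" using f by (simp add: pi_preimage_def)
    moreover have "val_ge (dotw w \<beta> - \<theta>) (coef (pi_map \<nu> p f) \<beta>) \<and> (\<forall>k::int. of_int k = dotw w \<beta> - \<theta> \<longrightarrow>
      val_ge (of_int k + 1) (coef (pi_map \<nu> p f) \<beta> -
        fps_nth_int (coef (initial_form (-1, w) f) \<beta>) k * p powi k))" for \<beta>
    proof -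
      define e where "e = coef (pi_map \<nu> p f) \<beta>"
      have rem: "val_ge (real n) (e - (\<Sum>k<n. fps_nth (coef f \<beta>) k * p ^ k))" for n
        unfolding e_def coef_pi_map by (rule fps_eval_at_remainder) (rule f_int)
      have zero: "fps_nth (coef f \<beta>) j = 0" if "real j < dotw w \<beta> - \<theta>" for j
        using le_m[of \<beta> j] that True by auto
      have e_ge: "val_ge (dotw w \<beta> - \<theta>) e"
      proof -
        \<comment> \<open>Every index below the ceiling lies below
          \<open>dotw w \<beta> - \<theta>\<close> itself; if the latter is negative, the sum is
          empty and integrality of \<open>e\<close> suffices.\<close>
        have "(\<Sum>k<nat \<lceil>dotw w \<beta> - \<theta>\<rceil>. fps_nth (coef f \<beta>) k * p ^ k) = 0"
          by (rule sum.neutral) (auto intro!: zero, linarith)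
        then show ?thesis
          using val_ge_mono[OF rem[of "nat \<lceil>dotw w \<beta> - \<theta>\<rceil>"], of "dotw w \<beta> - \<theta>"] by simp linarith
      qed
      have "val_ge (of_int k + 1) (e - fps_nth_int (coef (initial_form (-1, w) f) \<beta>) k * p powi k)"
        if k: "of_int k = dotw w \<beta> - \<theta>" for k
      proof (cases "k \<ge> 0")
        case True
        then obtain n where n: "k = int n" using nonneg_int_cases by blast
        \<comment> \<open>Truncation after index n keeps the term of weight \<theta> and gives a
          remainder of value at least n + 1.\<close>
        have "(\<Sum>k<Suc n. fps_nth (coef f \<beta>) k * p ^ k) = fps_nth (coef f \<beta>) n * p ^ n"
          using k n zero by (simp add: sum.neutral)
        then show ?thesis
          using rem[of "Suc n"] k n \<open>\<theta> = m\<close> by (simp add: fps_nth_int_def in_f add.commute)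
      next
        case neg: False
        \<comment> \<open>At negative k there is no coefficient to match, and integrality of
          \<open>e\<close> is enough.\<close>
        then have "real_of_int k + 1 \<le> 0" by linarith
        then show ?thesis using val_ge_mono[OF rem[of 0]] neg by (simp add: fps_nth_int_def)
      qed
      then show ?thesis using e_ge unfolding e_def by blast
    qed
    ultimately show ?thesis unfolding lifts_to_def by blast
  qed
qed

text \<open>The coefficients of \<open>h\<close> are polynomials in t, so \<open>h\<close> is a
  finite sum of terms r t^j x^\<gamma>, to which \<open>lifts_to_monomial_mult\<close> applies one
  by one.\<close>

lemma lifts_to_RTx_poly_mult:
  assumes I: "is_ideal_in UNIV I" and R: "R \<subseteq> val_ring \<nu>" and h: "h \<in> RTx_poly R"
    and g: "\<And>\<theta>. lifts_to w I \<theta> (\<lambda>\<beta>. fps_nth_int (coef g \<beta>))"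
  shows "lifts_to w I \<theta> (\<lambda>\<beta>. fps_nth_int (coef (h * g) \<beta>))"
proof -
  define M where "M \<gamma> j = Poly_Mapping.single \<gamma> (fps_const (fps_nth (coef h \<gamma>) j) * fps_X ^ j) * g" for \<gamma> j
  define A where "A \<gamma> = {j. fps_nth (coef h \<gamma>) j \<noteq> 0}" for \<gamma>
  have fin: "finite (A \<gamma>)" for \<gamma> using h by (simp add: A_def RTx_poly_def)
  have coef_h: "coef h \<gamma> = (\<Sum>j\<in>A \<gamma>. fps_const (fps_nth (coef h \<gamma>) j) * fps_X ^ j)" for \<gamma>
    using fin[of \<gamma>] by (intro fps_ext) (auto simp: fps_sum_nth A_def if_distrib cong: if_cong)
  have single: "Poly_Mapping.single \<gamma> (coef h \<gamma>) * g = (\<Sum>j\<in>A \<gamma>. M \<gamma> j)" for \<gamma>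
    unfolding M_def by (subst coef_h) (simp only: single_sum sum_distrib_right)
  have "h * g = (\<Sum>\<gamma>\<in>Poly_Mapping.keys h. Poly_Mapping.single \<gamma> (coef h \<gamma>)) * g"
    by (simp add: poly_mapping_sum_single)
  then have hg: "h * g = (\<Sum>\<gamma>\<in>Poly_Mapping.keys h. \<Sum>j\<in>A \<gamma>. M \<gamma> j)"
    by (simp add: sum_distrib_right single)
  have "lifts_to w I \<theta> (\<lambda>\<beta>. fps_nth_int (coef (M \<gamma> j) \<beta>))" for \<gamma> j
  proof (rule lifts_to_monomial_mult[OF I g])
    show "val_ge 0 (fps_nth (coef h \<gamma>) j)"
      using h R by (auto simp: RTx_poly_def RTx_def val_ring_iff[symmetric])
    show "fps_nth_int (coef (M \<gamma> j) (\<gamma> + \<delta>)) k =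
        fps_nth (coef h \<gamma>) j * fps_nth_int (coef g \<delta>) (k - int j)" for \<delta> k
      by (auto simp: M_def coef_single_mult fps_nth_int_def mult.assoc fps_X_power_mult_nth nat_diff_distrib)
    show "fps_nth_int (coef (M \<gamma> j) \<beta>) k = 0" if "\<And>\<delta>. \<beta> \<noteq> \<gamma> + \<delta>" for \<beta> k
    proof -
      have "coef (M \<gamma> j) \<beta> = 0" unfolding M_def using that by (rule coef_single_mult_eq_0)
      then show ?thesis by (simp add: fps_nth_int_def)
    qed
  qed
  then have "lifts_to w I \<theta> (\<lambda>\<beta> k. \<Sum>\<gamma>\<in>Poly_Mapping.keys h. \<Sum>j\<in>A \<gamma>. fps_nth_int (coef (M \<gamma> j) \<beta>) k)"
    by (intro lifts_to_sum I fin finite_keys)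
  also have "(\<lambda>\<beta> k. \<Sum>\<gamma>\<in>Poly_Mapping.keys h. \<Sum>j\<in>A \<gamma>. fps_nth_int (coef (M \<gamma> j) \<beta>) k) =
      (\<lambda>\<beta>. fps_nth_int (coef (h * g) \<beta>))"
    by (auto simp: fun_eq_iff hg lookup_sum fps_sum_nth fps_nth_int_def)
  finally show ?thesis .
qed

text \<open>The monomial t^b x^\<alpha> in the ideal is homogeneous of weight
  \<open>dotw w \<alpha> - real b\<close>; the lift of the part of that weight has its dominant term
  at \<alpha>.\<close>

lemma initial_has_monomial_imp_dominant_term:
  assumes I: "is_ideal_in UNIV I" and R: "R \<subseteq> val_ring \<nu>"
    and "initial_has_monomial R (-1, w) (pi_preimage \<nu> p R I)"
  obtains F \<alpha> where "F \<in> I" "has_dominant_term w F \<alpha>"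
proof -
  obtain \<alpha> b where "Poly_Mapping.single \<alpha> (fps_X ^ b) \<in>
      ideal_span_in (RTx_poly R) (initial_form (-1, w) ` pi_preimage \<nu> p R I)"
    using assms(3) unfolding initial_has_monomial_def by blast
  then obtain m h s where eq: "Poly_Mapping.single \<alpha> (fps_X ^ b) = (\<Sum>i<(m::nat). h i * s i)"
    and hs: "\<And>i. i < m \<Longrightarrow> h i \<in> RTx_poly R \<and> s i \<in> initial_form (-1, w) ` pi_preimage \<nu> p R I"
    unfolding ideal_span_in_def by auto
  define G where "G \<beta> k = fps_nth_int (coef (Poly_Mapping.single \<alpha> (fps_X ^ b)) \<beta>) k" for \<beta> k
  have "lifts_to w I (dotw w \<alpha> - real b) (\<lambda>\<beta> k. \<Sum>i<m. fps_nth_int (coef (h i * s i) \<beta>) k)"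
    using hs by (intro lifts_to_sum lifts_to_RTx_poly_mult[OF I R] I) (auto 4 3 intro: lifts_to_initial_form[OF I R] dest: hs)
  also have "(\<lambda>\<beta> k. \<Sum>i<m. fps_nth_int (coef (h i * s i) \<beta>) k) = G"
    by (auto simp: fun_eq_iff G_def eq lookup_sum fps_sum_nth fps_nth_int_def)
  finally have "lifts_to w I (dotw w \<alpha> - real b) G" .
  moreover have "\<nu> (G \<alpha> (int b)) = 0" by (simp add: G_def fps_nth_int_def)
  moreover have "val_ge 1 (G \<beta> k)" if "\<beta> \<noteq> \<alpha>" for \<beta> k
    using that by (simp add: G_def lookup_single fps_nth_int_def)
  ultimately obtain F where "F \<in> I" "has_dominant_term w F \<alpha>"
    by (elim lifts_to_imp_dominant_term[where b = "int b"]) auto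
  then show thesis by (rule that)
qed

section \<open>From a dominant term to monomials at all nearby weights\<close>

lemma fps_eval_at_X_power: "fps_eval_at \<nu> p (fps_X ^ N) = p ^ N"
proof (rule fps_eval_at_eqI)
  have "(\<Sum>k<n. fps_nth (fps_X ^ N) k * p ^ k) = p ^ N" if "n > N" for n
    using that by (simp add: if_distrib[of "\<lambda>x. x * _"] cong: if_cong)
  then show "val_converges \<nu> (\<lambda>n. \<Sum>k<n. fps_nth (fps_X ^ N) k * p ^ k) (p ^ N)"
    unfolding val_converges_def by (intro allI exI[of _ "Suc N"]) auto
qed

text \<open>Scaling shifts all valued weights equally and so preserves dominance. The factor makes
  the dominant coefficient a pure power of p and all coefficients integral, ready for
  lifting.\<close>

lemma dominant_term_normalize:
  assumes I: "is_ideal_in UNIV I" and F: "F \<in> I" "has_dominant_term w F \<alpha>"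
  obtains E N v where "E \<in> I" "coef E \<alpha> = p ^ N"
    "\<And>\<beta>. coef E \<beta> \<noteq> 0 \<Longrightarrow> \<nu> (coef E \<beta>) = ereal (real (v \<beta>))"
    "\<And>\<beta>. coef E \<beta> \<noteq> 0 \<Longrightarrow> \<beta> \<noteq> \<alpha> \<Longrightarrow> dotw w \<beta> - real (v \<beta>) < dotw w \<alpha> - real N"
proof -
  have nz: "coef F \<alpha> \<noteq> 0" using F(2) by (simp add: has_dominant_term_def)
  have "\<forall>\<beta>. \<exists>k::int. coef F \<beta> \<noteq> 0 \<longrightarrow> \<nu> (coef F \<beta>) = ereal (of_int k)"
    using val_int by metis
  then obtain u where u: "\<And>\<beta>. coef F \<beta> \<noteq> 0 \<Longrightarrow> \<nu> (coef F \<beta>) = ereal (of_int (u \<beta>))"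
    by metis
  \<comment> \<open>The sum of the nonnegative parts is a convenient bound for every difference
    \<open>u \<alpha> - u \<beta>\<close>.\<close>
  define N where "N = (\<Sum>\<beta>\<in>Poly_Mapping.keys F. nat (u \<alpha> - u \<beta>))"
  have N: "u \<alpha> - u \<beta> \<le> int N" if "coef F \<beta> \<noteq> 0" for \<beta>
  proof -
    have "nat (u \<alpha> - u \<beta>) \<le> N"
      unfolding N_def using that by (intro member_le_sum) (auto simp: in_keys_iff)
    then show ?thesis by linarith
  qed
  define E where "E = Poly_Mapping.single 0 (p ^ N * inverse (coef F \<alpha>)) * F"
  have c: "coef E \<beta> = p ^ N * inverse (coef F \<alpha>) * coef F \<beta>" for \<beta>
    using coef_single_mult[of 0 _ F \<beta>] by (simp add: E_def)
  have E_nz: "coef E \<beta> \<noteq> 0 \<longleftrightarrow> coef F \<beta> \<noteq> 0" for \<beta> using nz by (simp add: c)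
  have "E \<in> I" using I F(1) unfolding E_def is_ideal_in_def by blast
  moreover have "coef E \<alpha> = p ^ N" using nz by (simp add: c)
  moreover have "\<nu> (coef E \<beta>) = ereal (real (nat (int N - u \<alpha> + u \<beta>)))" if "coef E \<beta> \<noteq> 0" for \<beta>
    using that N[of \<beta>] val_inverse[OF nz u[OF nz]] u[of \<beta>]
    by (simp add: c[of \<beta>] val_mult val_p_power E_nz)
  moreover have "dotw w \<beta> - real (nat (int N - u \<alpha> + u \<beta>)) < dotw w \<alpha> - real N"
    if "coef E \<beta> \<noteq> 0" "\<beta> \<noteq> \<alpha>" for \<beta>
  proof -
    have "coef F \<beta> \<noteq> 0" using that E_nz by simp
    moreover from this have "dotw w \<beta> - of_int (u \<beta>) < dotw w \<alpha> - of_int (u \<alpha>)"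
      using F(2) that(2) u[of \<beta>] u[of \<alpha>] nz
      by (auto simp: has_dominant_term_def val_weight_def in_keys_iff)
    ultimately show ?thesis using N[of \<beta>] by simp
  qed
  ultimately show thesis by (rule that)
qed

text \<open>Lift the normalized element so that the coefficient at \<beta> is divisible by t to the
  power \<open>v \<beta>\<close>. That t^N x^\<alpha> outweighs every other term then amounts to
  finitely many strict inequalities in the weight, an open condition.\<close>

lemma dominant_term_imp_initial_has_monomial_near:
  assumes I: "is_ideal_in UNIV I" and F: "F \<in> I" "has_dominant_term w F \<alpha>"
    and R: "R \<subseteq> val_ring \<nu>" "dense_in_val_ring \<nu> R" "is_subring R"
  obtains U where "open U" "(-1, w) \<in> U"
    "\<And>W. W \<in> U \<Longrightarrow> fst W < 0 \<Longrightarrow> initial_has_monomial R W (pi_preimage \<nu> p R I)"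
proof -
  obtain E N v where E: "E \<in> I" "coef E \<alpha> = p ^ N"
    "\<And>\<beta>. coef E \<beta> \<noteq> 0 \<Longrightarrow> \<nu> (coef E \<beta>) = ereal (real (v \<beta>))"
    "\<And>\<beta>. coef E \<beta> \<noteq> 0 \<Longrightarrow> \<beta> \<noteq> \<alpha> \<Longrightarrow> dotw w \<beta> - real (v \<beta>) < dotw w \<alpha> - real N"
    using dominant_term_normalize[OF I F] by metis
  have R01: "0 \<in> R" "1 \<in> R" using R(3) by (auto simp: is_subring_def)
  have "\<exists>f. (\<forall>k. fps_nth f k \<in> R) \<and> (\<forall>k<v \<beta>. fps_nth f k = 0) \<and> fps_eval_at \<nu> p f = coef E \<beta>"
    if "coef E \<beta> \<noteq> 0" for \<beta>
    using dense_lift[OF R(1,2) R01(1), of "v \<beta>" "coef E \<beta>"] E(3)[OF that]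
    unfolding val_ge_def by (metis order_refl)
  then obtain l where l: "\<And>\<beta> k. coef E \<beta> \<noteq> 0 \<Longrightarrow> fps_nth (l \<beta>) k \<in> R"
    "\<And>\<beta> k. coef E \<beta> \<noteq> 0 \<Longrightarrow> k < v \<beta> \<Longrightarrow> fps_nth (l \<beta>) k = 0"
    "\<And>\<beta>. coef E \<beta> \<noteq> 0 \<Longrightarrow> fps_eval_at \<nu> p (l \<beta>) = coef E \<beta>"
    by metis
  \<comment> \<open>At \<alpha> the lift is exactly t^N instead of a digit expansion, so that row
    contributes a single term with coefficient 1.\<close>
  define f where "f = Poly_Mapping.mapp (\<lambda>\<beta> c. if \<beta> = \<alpha> then fps_X ^ N else l \<beta>) E"
  have f: "coef f \<beta> = (if coef E \<beta> = 0 then 0 else if \<beta> = \<alpha> then fps_X ^ N else l \<beta>)" for \<beta>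
    by (simp add: f_def lookup_mapp in_keys_iff)
  have "pi_map \<nu> p f = E"
    by (rule poly_mapping_eqI) (simp add: coef_pi_map f fps_eval_at_X_power E(2) l(3))
  moreover have "f \<in> RTx R"
    using l(1) R01 by (simp add: RTx_def f)
  ultimately have f_mem: "f \<in> pi_preimage \<nu> p R I" using E(1) by (simp add: pi_preimage_def)
  \<comment> \<open>Comparing t^N x^\<alpha> with the lowest possible power of t at each \<beta> is
    enough.\<close>
  define U where "U = (\<Inter>\<beta>\<in>Poly_Mapping.keys E - {\<alpha>}. {W. t_weight W \<beta> (v \<beta>) < t_weight W \<alpha> N})"
  have "open U"
    unfolding U_def t_weight_def dotw_def
    by (intro open_INT ballI open_Collect_less continuous_intros) auto
  moreover have "(-1, w) \<in> U"
    using E(4) by (fastforce simp: U_def t_weight_def in_keys_iff)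
  moreover have "initial_has_monomial R W (pi_preimage \<nu> p R I)" if W: "W \<in> U" "fst W < 0" for W
  proof -
    have less: "t_weight W \<beta> k < t_weight W \<alpha> N" if "fps_nth (coef f \<beta>) k \<noteq> 0" "(\<beta>, k) \<noteq> (\<alpha>, N)" for \<beta> k
    proof -
      have nz: "coef E \<beta> \<noteq> 0" and ne: "\<beta> \<noteq> \<alpha>" using that by (auto simp: f split: if_splits)
      then have "v \<beta> \<le> k" using that(1) l(2)[OF nz, of k] by (force simp: f)
      \<comment> \<open>The first coordinate of \<open>W\<close> is negative, so higher powers of t
        have lower weight.\<close>
      then have "t_weight W \<beta> k \<le> t_weight W \<beta> (v \<beta>)"
        using W(2) by (simp add: t_weight_def mult_left_mono_neg)
      also have "\<dots> < t_weight W \<alpha> N"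
        using W(1) nz ne by (auto simp: U_def in_keys_iff)
      finally show ?thesis .
    qed
    have f_\<alpha>: "coef f \<alpha> = fps_X ^ N" by (simp add: f E(2))
    have SUP: "(SUP (\<alpha>,\<beta>) \<in> {(\<alpha>,\<beta>). fps_nth (coef f \<alpha>) \<beta> \<noteq> 0}. t_weight W \<alpha> \<beta>) = t_weight W \<alpha> N"
    proof (rule cSup_eq_maximum)
      show "t_weight W \<alpha> N \<in> (\<lambda>(\<alpha>,\<beta>). t_weight W \<alpha> \<beta>) ` {(\<alpha>,\<beta>). fps_nth (coef f \<alpha>) \<beta> \<noteq> 0}"
        by (rule image_eqI[of _ _ "(\<alpha>, N)"]) (auto simp: f_\<alpha>)
      show "x \<le> t_weight W \<alpha> N"
        if "x \<in> (\<lambda>(\<alpha>,\<beta>). t_weight W \<alpha> \<beta>) ` {(\<alpha>,\<beta>). fps_nth (coef f \<alpha>) \<beta> \<noteq> 0}" for x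
      proof -
        from that obtain \<beta> k where x: "x = t_weight W \<beta> k" "fps_nth (coef f \<beta>) k \<noteq> 0" by auto
        then show ?thesis using less[of \<beta> k] by (cases "(\<beta>, k) = (\<alpha>, N)") auto
      qed
    qed
    have "fps_nth (coef (initial_form W f) \<beta>) k =
        fps_nth (coef (Poly_Mapping.single \<alpha> (fps_X ^ N)) \<beta>) k" for \<beta> k
    proof (cases "(\<beta>, k) = (\<alpha>, N)")
      case True
      then show ?thesis by (simp add: nth_coef_initial_form SUP f_\<alpha>)
    next
      case False
      then have "fps_nth (coef (initial_form W f) \<beta>) k = 0"
        using less[of \<beta> k] unfolding nth_coef_initial_form SUP
        by (cases "fps_nth (coef f \<beta>) k = 0") auto
      then show ?thesis using False by (auto simp: lookup_single when_def)
    qed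
    then have in_f: "initial_form W f = Poly_Mapping.single \<alpha> (fps_X ^ N)"
      by (simp add: poly_mapping_eq_iff fun_eq_iff fps_eq_iff)
    have "initial_form W f \<in>
        ideal_span_in (RTx_poly R) (initial_form W ` pi_preimage \<nu> p R I)"
    proof -
      have "(1 :: ('a, 'k fps) mpoly) \<in> RTx_poly R"
        using R01 by (auto simp: RTx_poly_def RTx_def lookup_one when_def)
      then show ?thesis
        using f_mem by (rule mem_ideal_span_in[OF _ imageI])
    qed
    then show ?thesis unfolding initial_has_monomial_def in_f by blast
  qed
  ultimately show thesis by (rule that)
qed

end

theorem theorem2p12:
  fixes \<nu> :: "'k::field \<Rightarrow> ereal" and p :: 'k and R :: "'k set"
    and I :: "('n::finite, 'k) mpoly set"
  assumes "complete_dvf \<nu> p"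
    and "R \<subseteq> val_ring \<nu>" and "noetherian_subring R" and "dense_in_val_ring \<nu> R"
    and "p \<in> R"
    and "is_ideal_in UNIV I"
  shows "bij_betw snd (Trop R (pi_preimage \<nu> p R I) \<inter> {W. fst W = -1}) (Trop_val \<nu> p I)"
proof -
  interpret discrete_valuation \<nu> p by standard (rule assms(1))
  have R: "is_subring R" using assms(3) by (simp add: noetherian_subring_def)
  \<comment> \<open>The projection is injective on the slice, so only membership has to be
    compared.\<close>
  have "(-1, w) \<in> Trop R (pi_preimage \<nu> p R I) \<longleftrightarrow> w \<in> Trop_val \<nu> p I" for w
  proof
    assume mem: "(-1, w) \<in> Trop R (pi_preimage \<nu> p R I)"
    show "w \<in> Trop_val \<nu> p I"
      unfolding Trop_val_def mem_Collect_eq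
    proof
      assume "val_initial_has_monomial \<nu> p w I"
      then obtain F \<alpha> where F: "F \<in> I" "has_dominant_term w F \<alpha>"
        using val_initial_has_monomial_imp_dominant_term[OF assms(6)] by metis
      \<comment> \<open>A whole neighbourhood is needed because a point of \<open>Trop\<close> may
        arise only as a limit.\<close>
      obtain U where U: "open U" "(-1, w) \<in> U"
        "\<And>W. W \<in> U \<Longrightarrow> fst W < 0 \<Longrightarrow> initial_has_monomial R W (pi_preimage \<nu> p R I)"
        using dominant_term_imp_initial_has_monomial_near[OF assms(6) F assms(2,4) R] by metis
      have "U \<inter> {W. fst W < 0 \<and> \<not> initial_has_monomial R W (pi_preimage \<nu> p R I)} = {}"
        using U(3) by auto
      then have "U \<inter> Trop R (pi_preimage \<nu> p R I) = {}"
        unfolding Trop_def using open_Int_closure_eq_empty[OF U(1)] by simp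
      then show False
        using mem U(2) by auto
    qed
  next
    assume "w \<in> Trop_val \<nu> p I"
    \<comment> \<open>In this direction the point already lies in the set whose closure is
      taken.\<close>
    then have "\<not> initial_has_monomial R (-1, w) (pi_preimage \<nu> p R I)"
      using initial_has_monomial_imp_dominant_term[OF assms(6,2)]
        dominant_term_imp_val_initial_has_monomial unfolding Trop_val_def mem_Collect_eq by metis
    then show "(-1, w) \<in> Trop R (pi_preimage \<nu> p R I)"
      unfolding Trop_def by (intro subsetD[OF closure_subset]) simp
  qed
  then have "Trop R (pi_preimage \<nu> p R I) \<inter> {W. fst W = -1} = Pair (-1) ` Trop_val \<nu> p I"
    by auto
  then show ?thesis
    by (simp add: bij_betw_def inj_on_def image_image)
qed

end
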